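(* Let $f\in C[0,1]$, $\alpha\ge 1$, $0\le\beta\le 1$, $0\le\lambda\le 1$, and $\varphi(x)=\sqrt{x(1-x)}$. Then there is a constant $M>0$, independent of $n$ and $x$, such that for all integers $n\ge 2$ and all $x\in[0,1]$ $$\left|L_{n,\beta}^{(\alpha)}(f;x)-f(x)\right|\le M\,\omega_{\varphi^{\lambda}}\!\left(f;\frac{\varphi^{1-\lambda}(x)}{\sqrt n}\right).$$
   Context: $C[0,1]$ is the space of continuous real functions on $[0,1]$. For $n\ge 1$, $0\le k\le n$, let $p_{n,k}(x)=\binom nk x^k(1-x)^{n-k}$, $J_{n,k}(x)=\sum_{i=k}^n p_{n,i}(x)$ and $J_{n,n+1}(x)=0$. For $\alpha\ge1$ put $Q_{n,k}^{(\alpha)}(x)=J_{n,k}(x)^{\alpha}-J_{n,k+1}(x)^{\alpha}$. For $m\ge 1$, $1\le k\le m-1$, $\beta\in[0,1]$ and $f\in C[0,1]$, $$F_{m,k}^{(\beta)}(f)=\frac{1}{B(mk,m(m-k))}\int_0^1 t^{mk-1}(1-t)^{m(m-k)-1}f\!\left(\beta t+(1-\beta)\tfrac km\right)dt,$$ where $B(\cdot,\cdot)$ is the Beta function; for $k=m$ put $F_{m,m}^{(\beta)}(f)=f(1)$. For $n\ge 2$, $$L_{n,\beta}^{(\alpha)}(f;x)=f(0)Q_{n,0}^{(\alpha)}(x)+\sum_{k=1}^{n-1}Q_{n,k}^{(\alpha)}(x)F_{n-1,k}^{(\beta)}(f)+f(1)Q_{n,n}^{(\alpha)}(x).$$ With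 $\varphi^{\lambda}(x)=(\varphi(x))^{\lambda}$ (and $\varphi^0\equiv 1$), the Ditzian–Totik modulus is $$\omega_{\varphi^{\lambda}}(f;t)=\sup_{0<h\le t}\ \sup_{x\pm\frac{h\varphi^{\lambda}(x)}{2}\in[0,1]}\left|f\!\left(x+\tfrac{h\varphi^{\lambda}(x)}{2}\right)-f\!\left(x-\tfrac{h\varphi^{\lambda}(x)}{2}\right)\right|,$$ where the inner supremum is over $x\in[0,1]$ with both $x\pm\frac{h\varphi^\lambda(x)}2$ in $[0,1]$, and $\omega_{\varphi^\lambda}(f;0)=0$. *)

theory Defs
  imports "HOL-Analysis.Analysis"
begin

definition bern :: "nat \<Rightarrow> nat \<Rightarrow> real \<Rightarrow> real" where
  "bern n k x = real (n choose k) * x ^ k * (1 - x) ^ (n - k)"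

text \<open>For \<open>k = n + 1\<close> the sum is empty, so the convention \<open>J n (n + 1) x = 0\<close> is automatic.\<close>

definition bezier_J :: "nat \<Rightarrow> nat \<Rightarrow> real \<Rightarrow> real" where
  "bezier_J n k x = (\<Sum>i=k..n. bern n i x)"

text \<open>On \<open>[0,1]\<close> the bases are nonnegative, and \<open>0 powr \<alpha> = 0\<close> agrees with
  \<open>0\<^sup>\<alpha>\<close> for \<open>\<alpha> \<ge> 1\<close>.\<close>

definition bezier_Q :: "real \<Rightarrow> nat \<Rightarrow> nat \<Rightarrow> real \<Rightarrow> real" where
  "bezier_Q \<alpha> n k x = bezier_J n k x powr \<alpha> - bezier_J n (k + 1) x powr \<alpha>"

text \<open>Used for \<open>1 \<le> k \<le> m\<close> only. For \<open>1 \<le> k < m\<close> both exponents are natural numbers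
  without truncation.\<close>

definition beta_functional :: "real \<Rightarrow> nat \<Rightarrow> nat \<Rightarrow> (real \<Rightarrow> real) \<Rightarrow> real" where
  "beta_functional \<beta> m k f =
     (if k = m then f 1
      else 1 / Beta (real (m * k)) (real (m * (m - k))) *
        integral {0..1} (\<lambda>t. t ^ (m * k - 1) * (1 - t) ^ (m * (m - k) - 1) *
          f (\<beta> * t + (1 - \<beta>) * (real k / real m))))"

definition L_op :: "real \<Rightarrow> real \<Rightarrow> nat \<Rightarrow> (real \<Rightarrow> real) \<Rightarrow> real \<Rightarrow> real" where
  "L_op \<alpha> \<beta> n f x =
     f 0 * bezier_Q \<alpha> n 0 x
     + (\<Sum>k=1..n - 1. bezier_Q \<alpha> n k x * beta_functional \<beta> (n - 1) k f)
     + f 1 * bezier_Q \<alpha> n n x"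

definition phi :: "real \<Rightarrow> real" where
  "phi x = sqrt (x * (1 - x))"

text \<open>The case distinction makes the zeroth power identically 1, also at the endpoints
  (where \<open>0 powr 0 = 0\<close>).\<close>

definition phi_pow :: "real \<Rightarrow> real \<Rightarrow> real" where
  "phi_pow lam x = (if lam = 0 then 1 else phi x powr lam)"

text \<open>The iterated supremum is written as one supremum over the admissible pairs \<open>(h, x)\<close>, so
  that those \<open>h\<close> with no admissible \<open>x\<close> contribute nothing (the supremum of the empty set of
  reals being unspecified). For \<open>t > 0\<close> the set is nonempty: take \<open>x = 1/2\<close> and
  \<open>h = min t 1\<close> when \<open>lam \<ge> 0\<close>.\<close>

definition DT_modulus :: "real \<Rightarrow> (real \<Rightarrow> real) \<Rightarrow> real \<Rightarrow> real" where
  "DT_modulus lam f t =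
     (if t = 0 then 0
      else Sup {\<bar>f (x + h * phi_pow lam x / 2) - f (x - h * phi_pow lam x / 2)\<bar> | h x.
        0 < h \<and> h \<le> t \<and> x \<in> {0..1} \<and>
        x + h * phi_pow lam x / 2 \<in> {0..1} \<and> x - h * phi_pow lam x / 2 \<in> {0..1}})"

end

theory Submission
  imports Defs
begin

text \<open>Two points \<open>a < b\<close> of \<open>[0,1]\<close> with \<open>b - a \<le> h * phi_pow lam ((a + b) / 2)\<close> satisfy
  \<open>\<bar>f a - f b\<bar> \<le> DT_modulus lam f h\<close>. Chaining such steps, taken equidistant in the variable
  \<open>y powr (1 - lam / 2)\<close> on \<open>[0,1/2]\<close> and in its mirror image on \<open>[1/2,1]\<close>, gives
  \<open>\<bar>f t - f x\<bar> \<le> (2 + 4 * \<bar>t - x\<bar> / (h * phi_pow lam x)) * DT_modulus lam f h\<close> without any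
  K-functional. For \<open>h = phi_pow (1 - lam) x / sqrt n\<close> the denominator is \<open>phi x / sqrt n\<close>, so
  it remains to bound the second central moment of the operator by a multiple of
  \<open>(phi x)\<^sup>2 / n\<close>. As \<open>Q\<^sub>n\<^sub>,\<^sub>k \<le> \<alpha> * p\<^sub>n\<^sub>,\<^sub>k\<close>, this reduces to binomial moments and the variance of
  the Beta distribution.\<close>

section \<open>The Bezier basis compared with the Bernstein basis\<close>

text \<open>Mean value theorem: on \<open>(0,1]\<close> the derivative
  \<open>\<alpha> * z powr (\<alpha> - 1)\<close> is at most \<open>\<alpha>\<close>. The case
  \<open>b = 0\<close> is separate because the derivative rule for \<open>powr\<close> asks for a
  positive base.\<close>

lemma powr_diff_le:
  fixes a b \<alpha> :: real
  assumes "0 \<le> b" "b \<le> a" "a \<le> 1" "\<alpha> \<ge> 1"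
  shows "a powr \<alpha> - b powr \<alpha> \<le> \<alpha> * (a - b)"
proof (cases "b = 0 \<or> a = b")
  case True
  have "a powr \<alpha> \<le> a powr 1"
    using assms by (intro powr_mono') auto
  moreover have "a \<le> \<alpha> * a"
    using assms by (simp add: mult_le_cancel_right1)
  ultimately show ?thesis
    using True assms by auto
next
  case False
  then have "b < a" "0 < b"
    using assms by auto
  have "\<exists>z>b. z < a \<and> a powr \<alpha> - b powr \<alpha> = (a - b) * (\<alpha> * z powr (\<alpha> - 1))"
    by (rule MVT2[OF \<open>b < a\<close>]) (use \<open>0 < b\<close> in \<open>auto intro!: derivative_eq_intros\<close>)
  then obtain z where z: "b < z" "z < a"
    and eq: "a powr \<alpha> - b powr \<alpha> = (a - b) * (\<alpha> * z powr (\<alpha> - 1))"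
    by blast
  have "z powr (\<alpha> - 1) \<le> 1"
    using z \<open>0 < b\<close> assms by (intro powr_le1) auto
  then have "\<alpha> * z powr (\<alpha> - 1) \<le> \<alpha>"
    using assms by (simp add: mult_le_cancel_left1)
  then have "(a - b) * (\<alpha> * z powr (\<alpha> - 1)) \<le> (a - b) * \<alpha>"
    using assms by (intro mult_left_mono) auto
  then show ?thesis
    by (simp add: eq mult.commute)
qed

lemma bern_eq_Bernstein: "bern n k x = Bernstein n k x"
  by (simp add: bern_def Bernstein_def)

lemma bern_nonneg: "x \<in> {0..1} \<Longrightarrow> 0 \<le> bern n k x"
  by (simp add: bern_eq_Bernstein Bernstein_nonneg)

lemma sum_bern: "(\<Sum>k\<le>n. bern n k x) = 1"
  by (simp add: bern_eq_Bernstein)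

lemma bezier_J_nonneg: "x \<in> {0..1} \<Longrightarrow> 0 \<le> bezier_J n k x"
  by (simp add: bezier_J_def sum_nonneg bern_nonneg)

lemma bezier_J_0: "bezier_J n 0 x = 1"
  by (simp add: bezier_J_def sum_bern flip: atMost_atLeast0)

lemma bezier_J_Suc: "k \<le> n \<Longrightarrow> bezier_J n k x = bern n k x + bezier_J n (Suc k) x"
  by (simp add: bezier_J_def sum.atLeast_Suc_atMost)

lemma bezier_J_le_1:
  assumes "x \<in> {0..1}"
  shows "bezier_J n k x \<le> 1"
proof -
  have "bezier_J n k x \<le> (\<Sum>i\<in>{0..n}. bern n i x)"
    unfolding bezier_J_def using assms by (intro sum_mono2) (auto simp: bern_nonneg)
  then show ?thesis
    by (simp add: sum_bern flip: atMost_atLeast0)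
qed

lemma bezier_Q_nonneg:
  assumes "x \<in> {0..1}" "k \<le> n" "\<alpha> \<ge> 1"
  shows "0 \<le> bezier_Q \<alpha> n k x"
  unfolding bezier_Q_def
  using assms by (simp add: powr_mono2 bezier_J_nonneg bezier_J_Suc bern_nonneg)

text \<open>Consecutive tails \<open>bezier_J\<close> differ by one Bernstein polynomial, and
  \<open>y powr \<alpha>\<close> is Lipschitz on \<open>[0,1]\<close> with constant
  \<open>\<alpha>\<close>. This transfers binomial moment bounds to the Bezier weights.\<close>

lemma bezier_Q_le_bern:
  assumes "x \<in> {0..1}" "k \<le> n" "\<alpha> \<ge> 1"
  shows "bezier_Q \<alpha> n k x \<le> \<alpha> * bern n k x"
proof -
  have "bezier_Q \<alpha> n k x \<le> \<alpha> * (bezier_J n k x - bezier_J n (Suc k) x)"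
    unfolding bezier_Q_def Suc_eq_plus1[symmetric]
    using assms bezier_J_le_1[of x n k]
    by (intro powr_diff_le) (auto simp: bezier_J_nonneg bezier_J_Suc bern_nonneg)
  then show ?thesis
    using assms by (simp add: bezier_J_Suc)
qed

lemma sum_bezier_Q:
  assumes "\<alpha> \<ge> 1"
  shows "(\<Sum>k\<le>n. bezier_Q \<alpha> n k x) = 1"
proof -
  \<comment> \<open>The sum telescopes from the full sum, which is 1, to an empty tail, whose power
    is \<open>0 powr \<alpha> = 0\<close>.\<close>
  have "(\<Sum>k\<le>n. bezier_Q \<alpha> n k x) = bezier_J n 0 x powr \<alpha> - bezier_J n (Suc n) x powr \<alpha>"
    unfolding bezier_Q_def Suc_eq_plus1[symmetric] by (rule sum_telescope)
  then show ?thesis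
    unfolding bezier_J_0 by (simp add: bezier_J_def)
qed

section \<open>Mass and variance of the Beta density\<close>

text \<open>Natural powers and \<open>powr\<close> can differ only at the endpoints
  (\<open>0 powr 0 = 0\<close> but \<open>0 ^ 0 = 1\<close>), a null set for the integral.\<close>

lemma has_integral_Beta_nat:
  assumes "a > 0" "b > 0"
  shows "((\<lambda>t. t ^ (a - 1) * (1 - t) ^ (b - 1)) has_integral Beta (real a) (real b)) {0..1}"
proof -
  have "((\<lambda>t. t powr (real a - 1) * (1 - t) powr (real b - 1)) has_integral Beta (real a) (real b)) {0..1}"
    using assms by (intro has_integral_Beta_real) auto
  then show ?thesis
  proof (rule has_integral_spike_finite[of "{0,1}", rotated 2])
    fix t :: real assume "t \<in> {0..1} - {0,1}"
    then have "0 < t" "0 < 1 - t"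
      by auto
    then show "t ^ (a - 1) * (1 - t) ^ (b - 1) = t powr (real a - 1) * (1 - t) powr (real b - 1)"
      using assms by (simp add: powr_realpow[symmetric] of_nat_diff)
  qed simp
qed

text \<open>Here \<open>c\<close> is the mean of the Beta distribution. Expanding the square gives
  three Beta integrals, with first parameter \<open>a + 2\<close>, \<open>a + 1\<close> and
  \<open>a\<close>, which the recurrence of \<open>Beta\<close> reduces to one.\<close>

lemma has_integral_Beta_variance:
  assumes "a > 0" "b > 0" and c: "c = real a / (real a + real b)"
  shows "((\<lambda>t. t ^ (a - 1) * (1 - t) ^ (b - 1) * (t - c)\<^sup>2) has_integral
    Beta (real a) (real b) * (c * (1 - c) / (real a + real b + 1))) {0..1}"
proof -
  let ?w = "\<lambda>t::real. t ^ (a - 1) * (1 - t) ^ (b - 1)"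
  let ?B = "Beta (real a) (real b)"
  have B1: "Beta (real (a + 1)) (real b) = c * ?B"
    using Beta_plus1_left[of "real a" "real b"] assms nonpos_Ints_nonpos[of "real a"]
    by (force simp: field_simps)
  have B2: "Beta (real (a + 2)) (real b) = (real a + 1) / (real a + real b + 1) * c * ?B"
    using Beta_plus1_left[of "real (a + 1)" "real b"] assms(1,2) nonpos_Ints_nonpos[of "real (a + 1)"] B1
    by (force simp: field_simps)
  have eq: "(\<lambda>t. t ^ (a + 2 - 1) * (1 - t) ^ (b - 1) - 2 * c * (t ^ (a + 1 - 1) * (1 - t) ^ (b - 1))
      + c\<^sup>2 * ?w t) = (\<lambda>t. ?w t * (t - c)\<^sup>2)"
  proof
    fix t :: real
    \<comment> \<open>This removes the truncated subtraction in \<open>a - 1\<close>.\<close>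
    obtain a' where "a = Suc a'"
      using assms(1) gr0_implies_Suc by blast
    then show "t ^ (a + 2 - 1) * (1 - t) ^ (b - 1) - 2 * c * (t ^ (a + 1 - 1) * (1 - t) ^ (b - 1))
      + c\<^sup>2 * ?w t = ?w t * (t - c)\<^sup>2"
      by (simp add: power2_eq_square algebra_simps)
  qed
  have "((\<lambda>t. t ^ (a + 2 - 1) * (1 - t) ^ (b - 1) - 2 * c * (t ^ (a + 1 - 1) * (1 - t) ^ (b - 1))
      + c\<^sup>2 * ?w t) has_integral
      Beta (real (a + 2)) (real b) - 2 * c * Beta (real (a + 1)) (real b) + c\<^sup>2 * ?B) {0..1}"
    using assms
    by (intro has_integral_add has_integral_diff has_integral_mult_right has_integral_Beta_nat) auto
  moreover have "Beta (real (a + 2)) (real b) - 2 * c * Beta (real (a + 1)) (real b) + c\<^sup>2 * ?B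
      = ?B * (c * (1 - c) / (real a + real b + 1))"
  proof -
    have s: "real a + real b + 1 \<noteq> 0" "real a + real b \<noteq> 0"
      using assms by auto
    \<comment> \<open>Splitting off \<open>c\<close> exposes the squared mean inside the second
      moment, so that only the variance is left after cancellation.\<close>
    have "(real a + 1) / (real a + real b + 1) = c + (1 - c) / (real a + real b + 1)"
      unfolding c using s by (simp add: divide_simps) (simp add: algebra_simps)
    then show ?thesis
      unfolding B1 B2 by (simp add: algebra_simps power2_eq_square)
  qed
  ultimately show ?thesis
    unfolding eq by simp
qed

section \<open>The step weight, single steps of the modulus, and the power substitution\<close>

lemma phi_pow_eq_powr:
  assumes "0 < x" "x < 1"
  shows "phi_pow lam x = (x * (1 - x)) powr (lam / 2)"
  using assms by (simp add: phi_pow_def phi_def powr_half_sqrt[symmetric] powr_powr)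

lemma phi_pow_pos: "0 < x \<Longrightarrow> x < 1 \<Longrightarrow> 0 < phi_pow lam x"
  by (simp add: phi_pow_eq_powr)

lemma phi_pow_nonneg: "0 \<le> phi_pow lam x"
  by (simp add: phi_pow_def)

text \<open>The pair is a symmetric step about its midpoint \<open>x\<close> with parameter
  \<open>(b - a) / phi_pow lam x\<close>, which is at most \<open>h\<close>. A continuous
  \<open>f\<close> is bounded on \<open>[0,1]\<close>, so \<open>Sup\<close> really is an upper
  bound.\<close>

lemma diff_le_DT_modulus:
  assumes f: "continuous_on {0..1} f" and "0 < h"
    and ab: "0 \<le> a" "a < b" "b \<le> 1"
    and le: "b - a \<le> h * phi_pow lam ((a + b) / 2)"
  shows "\<bar>f a - f b\<bar> \<le> DT_modulus lam f h"
proof -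
  let ?S = "{\<bar>f (x + h' * phi_pow lam x / 2) - f (x - h' * phi_pow lam x / 2)\<bar> | h' x.
        0 < h' \<and> h' \<le> h \<and> x \<in> {0..1} \<and>
        x + h' * phi_pow lam x / 2 \<in> {0..1} \<and> x - h' * phi_pow lam x / 2 \<in> {0..1}}"
  define x where "x = (a + b) / 2"
  have x: "0 < x" "x < 1"
    using ab by (auto simp: x_def)
  define h' where "h' = (b - a) / phi_pow lam x"
  have pos: "0 < phi_pow lam x"
    using x by (rule phi_pow_pos)
  then have h': "0 < h'" "h' \<le> h" "h' * phi_pow lam x = b - a"
    using ab le by (auto simp: h'_def x_def[symmetric] field_simps)
  have "b = x + h' * phi_pow lam x / 2" "a = x - h' * phi_pow lam x / 2"
    unfolding h' by (simp_all add: x_def field_simps)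
  then have "\<bar>f b - f a\<bar> \<in> ?S"
    using x h' ab by fastforce
  moreover have "bdd_above ?S"
  proof -
    have "bounded (f ` {0..1})"
      using f by (intro compact_imp_bounded compact_continuous_image) auto
    then obtain K where K: "\<And>y. y \<in> {0..1} \<Longrightarrow> \<bar>f y\<bar> \<le> K"
      unfolding bounded_iff by (metis image_eqI real_norm_def)
    show ?thesis
      by (intro bdd_aboveI[of _ "2 * K"]) (smt (verit) K mem_Collect_eq)
  qed
  ultimately have "\<bar>f b - f a\<bar> \<le> Sup ?S"
    by (rule cSup_upper)
  then show ?thesis
    using \<open>0 < h\<close> by (simp add: DT_modulus_def abs_minus_commute)
qed

lemma DT_modulus_nonneg:
  assumes f: "continuous_on {0..1} f" and "0 \<le> h"
  shows "0 \<le> DT_modulus lam f h"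
proof (cases "h = 0")
  case True
  then show ?thesis
    by (simp add: DT_modulus_def)
next
  case False
  \<comment> \<open>Half the length of a step centred at \<open>1/2\<close>: the first bound keeps
    it inside \<open>[0,1]\<close>, the second makes it admissible for \<open>h\<close>.\<close>
  define d where "d = min (1/2) (h * phi_pow lam (1/2) / 2)"
  have "0 < d" "d \<le> 1/2" "2 * d \<le> h * phi_pow lam (1/2)"
    using False assms phi_pow_pos[of "1/2" lam] by (auto simp: d_def)
  then have "\<bar>f (1/2 - d) - f (1/2 + d)\<bar> \<le> DT_modulus lam f h"
    using False assms by (intro diff_le_DT_modulus) auto
  then show ?thesis
    by linarith
qed

text \<open>On \<open>[0, 1/2]\<close> the points \<open>a < b\<close> are joined by one admissible step once their
  \<open>powr (1 - s)\<close>-images are close, where \<open>s = lam / 2\<close>: this power is comparable to a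
  primitive of \<open>1 / phi_pow lam\<close>.\<close>

lemma powr_one_minus_diff:
  fixes a b s :: real
  assumes "0 \<le> a" "a \<le> b" "0 < b" "0 \<le> s" "s \<le> 1/2"
  shows diff_le_powr_one_minus_diff: "b - a \<le> 2 * b powr s * (b powr (1 - s) - a powr (1 - s))"
    and powr_one_minus_diff_le: "b powr s * (b powr (1 - s) - a powr (1 - s)) \<le> b - a"
proof -
  have b: "b powr s * b powr (1 - s) = b"
    using assms by (simp flip: powr_add)
  \<comment> \<open>Weighted AM-GM; since \<open>s \<le> 1/2\<close> and \<open>a \<le> b\<close>,
    the weighted mean is at most the midpoint. This costs the factor 2 in the first claim.\<close>
  have upper: "a powr (1 - s) * b powr s \<le> (a + b) / 2"
  proof (cases "a = 0")
    case False
    then have "a powr (1 - s) * b powr s \<le> (1 - s) * a + s * b"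
      using assms by (intro Youngs_inequality_0) auto
    also have "(1 - s) * a + s * b = (a + b) / 2 - (1/2 - s) * (b - a)"
      by (simp add: field_simps)
    also have "\<dots> \<le> (a + b) / 2"
      using mult_nonneg_nonneg[of "1/2 - s" "b - a"] assms by linarith
    finally show ?thesis .
  qed (use assms in auto)
  then show "b - a \<le> 2 * b powr s * (b powr (1 - s) - a powr (1 - s))"
    using b by (simp add: algebra_simps)
  have "a = a powr (1 - s) * a powr s"
    using assms by (simp flip: powr_add)
  also have "\<dots> \<le> a powr (1 - s) * b powr s"
    using assms by (intro mult_left_mono powr_mono2) auto
  finally show "b powr s * (b powr (1 - s) - a powr (1 - s)) \<le> b - a"
    using b by (simp add: algebra_simps)
qed

section \<open>Chaining single steps from \<open>x\<close> to \<open>t\<close>\<close>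

lemma chain_le:
  fixes g :: "real \<Rightarrow> real"
  assumes step: "\<And>u v. \<lbrakk>u \<in> {0..R}; v \<in> {0..R}; \<bar>u - v\<bar> \<le> c\<rbrakk> \<Longrightarrow> \<bar>g u - g v\<bar> \<le> W"
    and "u \<in> {0..R}" "v \<in> {0..R}" "\<bar>u - v\<bar> \<le> real N * c" "0 < c"
  shows "\<bar>g u - g v\<bar> \<le> real N * W"
  using assms(2-4)
proof (induction N arbitrary: v)
  case 0
  then show ?case
    by simp
next
  case (Suc N)
  \<comment> \<open>The last of the \<open>Suc N\<close> equal division points before
    \<open>v\<close>: it is within \<open>N * c\<close> of \<open>u\<close> and within
    \<open>c\<close> of \<open>v\<close>.\<close>
  define v' where "v' = u + (v - u) * (real N / real (Suc N))"
  have v': "v' = (1 - real N / real (Suc N)) * u + real N / real (Suc N) * v"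
    by (simp add: v'_def ring_distribs mult.commute diff_divide_distrib)
  have "v' \<in> {0..R}"
    unfolding v' using convexD[of "{0..R}" u v "1 - real N / real (Suc N)" "real N / real (Suc N)"]
      Suc.prems by (simp add: field_simps)
  moreover have "\<bar>u - v'\<bar> = \<bar>u - v\<bar> * (real N / real (Suc N))"
    by (simp add: v'_def abs_mult abs_minus_commute)
  moreover have "\<dots> \<le> (real (Suc N) * c) * (real N / real (Suc N))"
    using Suc.prems by (intro mult_right_mono) auto
  moreover have "(real (Suc N) * c) * (real N / real (Suc N)) = real N * c"
    by (simp del: of_nat_Suc)
  ultimately have "\<bar>g u - g v'\<bar> \<le> real N * W"
    using Suc.prems by (intro Suc.IH) (simp_all only:)
  moreover have "v' - v = (u - v) / real (Suc N)"
    unfolding v'_def by (simp add: field_simps)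
  then have "\<bar>v' - v\<bar> \<le> c"
    using Suc.prems(3) by (simp add: pos_divide_le_eq mult.commute del: of_nat_Suc)
  then have "\<bar>g v' - g v\<bar> \<le> W"
    using Suc.prems \<open>v' \<in> {0..R}\<close> by (intro step)
  ultimately show ?case
    by (simp add: algebra_simps)
qed

text \<open>In the variable \<open>y powr (1 - s)\<close> every step of length \<open>h / 4\<close>
  is admissible, so counting equal steps gives the bound; the summand 1 pays for rounding up. The
  single-step bound is a hypothesis with abstract \<open>W\<close>, which lets the lemma apply to
  the reflection of \<open>f\<close> as well.\<close>

lemma diff_le_half:
  fixes f :: "real \<Rightarrow> real"
  assumes step: "\<And>a b. \<lbrakk>0 \<le> a; a < b; b \<le> 1; b - a \<le> h * phi_pow lam ((a + b) / 2)\<rbrakk>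
      \<Longrightarrow> \<bar>f a - f b\<bar> \<le> W"
    and "0 < h" "0 \<le> W" "0 \<le> lam" "lam \<le> 1"
    and x: "0 < x" "x \<le> 1/2" and t: "0 \<le> t" "t \<le> 1/2"
  shows "\<bar>f t - f x\<bar> \<le> (1 + 4 * \<bar>t - x\<bar> / (h * x powr (lam / 2))) * W"
proof -
  define s where "s = lam / 2"
  have s: "0 \<le> s" "s \<le> 1/2"
    using assms by (auto simp: s_def)
  define g where "g u = f (u powr (1 / (1 - s)))" for u
  define R :: real where "R = (1/2) powr (1 - s)"
  have g: "g (y powr (1 - s)) = f y" if "0 \<le> y" for y
    using that s by (simp add: g_def powr_powr)
  have step0: "\<bar>f a - f b\<bar> \<le> W"
    if ab: "0 \<le> a" "a < b" "b \<le> 1/2" and le: "b powr (1 - s) - a powr (1 - s) \<le> h / 4" for a b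
  proof (rule step)
    \<comment> \<open>The 4 in \<open>h / 4\<close> is used up by two factors 2: one from the power
      estimate, the other from \<open>1/2 = (1/4) powr (1/2) \<le> (1/4) powr s\<close>. The
      midpoint and its complement are at least \<open>b / 2\<close> and \<open>1/2\<close>, hence
      \<open>b / 4\<close> is below their product.\<close>
    have "b - a \<le> 2 * b powr s * (b powr (1 - s) - a powr (1 - s))"
      using ab s by (intro diff_le_powr_one_minus_diff) auto
    also have "\<dots> \<le> 2 * b powr s * (h / 4)"
      using le by (intro mult_left_mono) auto
    also have "\<dots> = h * (b powr s * (1/2))"
      by simp
    also have "b powr s * (1/2) = b powr s * (1/4) powr (1/2)"
      by (simp add: powr_half_sqrt real_sqrt_divide)
    also have "\<dots> \<le> b powr s * (1/4) powr s"
      using s by (intro mult_left_mono powr_mono') auto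
    also have "\<dots> = (b / 4) powr s"
      using ab by (simp flip: powr_mult)
    also have "\<dots> \<le> ((a + b) / 2 * (1 - (a + b) / 2)) powr s"
    proof (rule powr_mono2)
      have "b / 2 * (1/2) \<le> (a + b) / 2 * (1 - (a + b) / 2)"
        using ab by (intro mult_mono) auto
      then show "b / 4 \<le> (a + b) / 2 * (1 - (a + b) / 2)"
        by simp
    qed (use ab s in auto)
    also have "\<dots> = phi_pow lam ((a + b) / 2)"
      using ab by (simp add: phi_pow_eq_powr s_def)
    finally show "b - a \<le> h * phi_pow lam ((a + b) / 2)"
      using \<open>0 < h\<close> by simp
  qed (use ab in auto)
  have gstep: "\<bar>g u - g v\<bar> \<le> W"
    if uv: "u \<in> {0..R}" "v \<in> {0..R}" and le: "\<bar>u - v\<bar> \<le> h / 4" for u v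
  proof -
    have inv: "u = (u powr (1 / (1 - s))) powr (1 - s)" "0 \<le> u powr (1 / (1 - s))"
      "u powr (1 / (1 - s)) \<le> 1/2" if "u \<in> {0..R}" for u
    proof -
      have "u powr (1 / (1 - s)) \<le> R powr (1 / (1 - s))"
        using that s by (intro powr_mono2) auto
      also have "\<dots> = 1/2"
        using s by (simp add: R_def powr_powr)
      finally show "u powr (1 / (1 - s)) \<le> 1/2" .
    qed (use that s in \<open>auto simp: powr_powr\<close>)
    define a where "a = u powr (1 / (1 - s))"
    define b where "b = v powr (1 / (1 - s))"
    have ab: "u = a powr (1 - s)" "v = b powr (1 - s)" "0 \<le> a" "0 \<le> b" "a \<le> 1/2" "b \<le> 1/2"
      using inv uv unfolding a_def b_def by auto
    have "\<bar>f a - f b\<bar> \<le> W"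
    proof (cases a b rule: linorder_cases)
      case less
      then show ?thesis
        using ab le by (intro step0) linarith+
    next
      case greater
      then have "\<bar>f b - f a\<bar> \<le> W"
        using ab le by (intro step0) linarith+
      then show ?thesis
        by (simp add: abs_minus_commute)
    qed (use \<open>0 \<le> W\<close> in auto)
    then show ?thesis
      using ab g by simp
  qed
  define D where "D = \<bar>t powr (1 - s) - x powr (1 - s)\<bar>"
  define N where "N = nat \<lceil>D / (h / 4)\<rceil>"
  have N: "D / (h / 4) \<le> real N" "real N \<le> 1 + D / (h / 4)"
    unfolding N_def using \<open>0 < h\<close> by (auto simp: D_def of_nat_nat) linarith
  have "\<bar>g (t powr (1 - s)) - g (x powr (1 - s))\<bar> \<le> real N * W"
  proof (rule chain_le[where c="h / 4", OF gstep])
    show "t powr (1 - s) \<in> {0..R}" "x powr (1 - s) \<in> {0..R}"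
      using x t s by (auto simp: R_def intro!: powr_mono2)
    show "\<bar>t powr (1 - s) - x powr (1 - s)\<bar> \<le> real N * (h / 4)"
      using N \<open>0 < h\<close> by (simp add: D_def field_simps)
  qed (use \<open>0 < h\<close> in auto)
  moreover have "real N \<le> 1 + 4 * \<bar>t - x\<bar> / (h * x powr s)"
  proof -
    \<comment> \<open>The power estimate carries the larger endpoint as its weight; if that is
      \<open>t\<close>, then \<open>x powr s \<le> t powr s\<close> still gives the bound at
      \<open>x\<close>.\<close>
    have "x powr s * D \<le> \<bar>t - x\<bar>"
    proof (cases "x \<le> t")
      case True
      have "t powr (1 - s) \<ge> x powr (1 - s)"
        using x s True by (intro powr_mono2) auto
      then have "x powr s * D \<le> t powr s * (t powr (1 - s) - x powr (1 - s))"
        unfolding D_def using x s True by (intro mult_mono powr_mono2) auto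
      also have "\<dots> \<le> t - x"
        using x s True by (intro powr_one_minus_diff_le) auto
      finally show ?thesis
        using True by simp
    next
      case False
      have "t powr (1 - s) \<le> x powr (1 - s)"
        using t s False by (intro powr_mono2) auto
      then show ?thesis
        unfolding D_def using t x s False powr_one_minus_diff_le[of t x s] by simp
    qed
    then have "D / (h / 4) \<le> 4 * \<bar>t - x\<bar> / (h * x powr s)"
      using \<open>0 < h\<close> x by (simp add: field_simps)
    then show ?thesis
      using N by linarith
  qed
  then have "real N * W \<le> (1 + 4 * \<bar>t - x\<bar> / (h * x powr s)) * W"
    using \<open>0 \<le> W\<close> by (rule mult_right_mono)
  ultimately show ?thesis
    using g x t by (simp add: s_def)
qed

text \<open>If \<open>t\<close> lies beyond \<open>1/2\<close>, the path is broken at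
  \<open>1/2\<close> and its right half is reflected by \<open>y \<mapsto> 1 - y\<close>, which
  preserves \<open>phi_pow\<close>. Two roundings give the 2, while the two distances add up to
  \<open>\<bar>t - x\<bar>\<close>.\<close>

lemma diff_le_left:
  fixes f :: "real \<Rightarrow> real"
  assumes step: "\<And>a b. \<lbrakk>0 \<le> a; a < b; b \<le> 1; b - a \<le> h * phi_pow lam ((a + b) / 2)\<rbrakk>
      \<Longrightarrow> \<bar>f a - f b\<bar> \<le> W"
    and h: "0 < h" and W: "0 \<le> W" and lam: "0 \<le> lam" "lam \<le> 1"
    and x: "0 < x" "x \<le> 1/2" and t: "0 \<le> t" "t \<le> 1"
  shows "\<bar>f t - f x\<bar> \<le> (2 + 4 * \<bar>t - x\<bar> / (h * phi_pow lam x)) * W"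
proof -
  let ?p = "x powr (lam / 2)"
  have p: "0 < ?p"
    using x by simp
  have "\<bar>f t - f x\<bar> \<le> (2 + 4 * \<bar>t - x\<bar> / (h * ?p)) * W"
  proof (cases "t \<le> 1/2")
    case True
    have "\<bar>f t - f x\<bar> \<le> (1 + 4 * \<bar>t - x\<bar> / (h * ?p)) * W"
      by (rule diff_le_half[OF step h W lam x t(1) True])
    also have "\<dots> \<le> (2 + 4 * \<bar>t - x\<bar> / (h * ?p)) * W"
      using W by (intro mult_right_mono) auto
    finally show ?thesis .
  next
    case False
    have step': "\<bar>f (1 - a) - f (1 - b)\<bar> \<le> W"
      if "0 \<le> a" "a < b" "b \<le> 1" "b - a \<le> h * phi_pow lam ((a + b) / 2)" for a b
    proof -
      have "phi_pow lam ((1 - b + (1 - a)) / 2) = phi_pow lam ((a + b) / 2)"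
        by (simp add: phi_pow_def phi_def field_simps)
      then have "\<bar>f (1 - b) - f (1 - a)\<bar> \<le> W"
        using that by (intro step) auto
      then show ?thesis
        by (simp add: abs_minus_commute)
    qed
    have "\<bar>f (1/2) - f x\<bar> \<le> (1 + 4 * \<bar>1/2 - x\<bar> / (h * ?p)) * W"
      using diff_le_half[where t="1/2", OF step h W lam x] by simp
    moreover have "\<bar>f t - f (1/2)\<bar> \<le> (1 + 4 * \<bar>t - 1/2\<bar> / (h * (1/2) powr (lam / 2))) * W"
      using diff_le_half[where f="\<lambda>y. f (1 - y)" and x="1/2" and t="1 - t", OF step' h W lam] False t
      by (simp add: abs_minus_commute)
    \<comment> \<open>As \<open>x \<le> 1/2\<close>, the weight at \<open>x\<close> is the smaller
      one and serves as a common denominator for both halves.\<close>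
    moreover have "\<dots> \<le> (1 + 4 * \<bar>t - 1/2\<bar> / (h * ?p)) * W"
      using h W x lam
      by (intro mult_right_mono add_left_mono divide_left_mono mult_left_mono powr_mono2) auto
    ultimately have "\<bar>f t - f x\<bar> \<le> (1 + 4 * \<bar>t - 1/2\<bar> / (h * ?p)) * W
        + (1 + 4 * \<bar>1/2 - x\<bar> / (h * ?p)) * W"
      by linarith
    also have "\<dots> = (2 + 4 * \<bar>t - x\<bar> / (h * ?p)) * W"
    proof -
      have eq: "\<bar>t - x\<bar> = \<bar>t - 1/2\<bar> + \<bar>1/2 - x\<bar>"
        using False x by linarith
      show ?thesis
        unfolding eq by (simp only: distrib_left add_divide_distrib) (simp only: distrib_right)
    qed
    finally show ?thesis .
  qed
  also have "\<dots> \<le> (2 + 4 * \<bar>t - x\<bar> / (h * phi_pow lam x)) * W"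
  proof -
    have "phi_pow lam x \<le> ?p"
      using x lam by (auto simp: phi_pow_eq_powr mult_left_le intro!: powr_mono2)
    then show ?thesis
      using h W x phi_pow_pos[of x lam]
      by (intro mult_right_mono add_left_mono divide_left_mono mult_left_mono) auto
  qed
  finally show ?thesis .
qed

text \<open>For \<open>x > 1/2\<close> the previous estimate is applied to \<open>f (1 - y)\<close>
  at \<open>1 - x\<close>; admissible steps reflect to admissible steps.\<close>

lemma diff_le_chain_DT_modulus:
  assumes f: "continuous_on {0..1} f" and h: "0 < h" and lam: "0 \<le> lam" "lam \<le> 1"
    and x: "0 < x" "x < 1" and t: "0 \<le> t" "t \<le> 1"
  shows "\<bar>f t - f x\<bar> \<le> (2 + 4 * \<bar>t - x\<bar> / (h * phi_pow lam x)) * DT_modulus lam f h"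
proof (cases "x \<le> 1/2")
  case True
  show ?thesis
    by (rule diff_le_left[OF diff_le_DT_modulus[OF f h] h DT_modulus_nonneg[OF f] lam x(1) True t])
      (use h in auto)
next
  case False
  have step: "\<bar>f (1 - a) - f (1 - b)\<bar> \<le> DT_modulus lam f h"
    if "0 \<le> a" "a < b" "b \<le> 1" "b - a \<le> h * phi_pow lam ((a + b) / 2)" for a b
  proof -
    have "phi_pow lam ((1 - b + (1 - a)) / 2) = phi_pow lam ((a + b) / 2)"
      by (simp add: phi_pow_def phi_def field_simps)
    then have "\<bar>f (1 - b) - f (1 - a)\<bar> \<le> DT_modulus lam f h"
      using that by (intro diff_le_DT_modulus f h) auto
    then show ?thesis
      by (simp add: abs_minus_commute)
  qed
  have "phi_pow lam (1 - x) = phi_pow lam x"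
    by (simp add: phi_pow_def phi_def mult.commute)
  then show ?thesis
    using diff_le_left[where f="\<lambda>y. f (1 - y)" and x="1 - x" and t="1 - t",
        OF step h DT_modulus_nonneg[OF f] lam]
      False h x t by (simp add: abs_minus_commute)
qed

section \<open>The Beta functional applied to a quadratic majorant\<close>

text \<open>The majorant is integrated against the Beta density of mean \<open>c\<close> and
  variance \<open>c * (1 - c) / (m^2 + 1)\<close>. For \<open>k = m\<close> the functional is
  evaluation at 1, where \<open>c = 1\<close> and the variance term vanishes.\<close>

lemma beta_functional_diff_le:
  fixes f :: "real \<Rightarrow> real"
  assumes f: "continuous_on {0..1} f" and k: "1 \<le> k" "k \<le> m" and \<beta>: "0 \<le> \<beta>" "\<beta> \<le> 1"
    and B: "0 \<le> B"
    and le: "\<And>t. t \<in> {0..1} \<Longrightarrow> \<bar>f t - y\<bar> \<le> A + B * (t - x)\<^sup>2"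
    and c: "c = real k / real m"
  shows "\<bar>beta_functional \<beta> m k f - y\<bar> \<le>
    A + B * (2 * (c * (1 - c) / (real m)\<^sup>2) + 2 * (c - x)\<^sup>2)"
proof (cases "k = m")
  case True
  then have "c = 1"
    using k c by simp
  moreover have "\<bar>f 1 - y\<bar> \<le> A + B * (1 - x)\<^sup>2"
    using le[of 1] by simp
  moreover have "B * (1 - x)\<^sup>2 \<le> B * (2 * (1 - x)\<^sup>2)"
    using B by (intro mult_left_mono) auto
  ultimately show ?thesis
    using True by (simp add: beta_functional_def)
next
  case False
  then have km: "k < m"
    using k by simp
  define a where "a = m * k"
  define b where "b = m * (m - k)"
  have ab: "0 < a" "0 < b"
    using k km by (auto simp: a_def b_def)
  \<comment> \<open>The Beta parameters add up to \<open>m^2\<close>, so the mean is exactly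
    \<open>k / m\<close> and the variance is of order \<open>1 / m^2\<close>.\<close>
  have "real a + real b = real (m * (k + (m - k)))"
    by (simp only: a_def b_def distrib_left of_nat_add)
  then have sum_ab: "real a + real b = (real m)\<^sup>2"
    using km by (simp add: power2_eq_square)
  have c_ab: "c = real a / (real a + real b)"
    unfolding sum_ab using km by (simp add: c a_def power2_eq_square)
  have c01: "0 \<le> c" "c \<le> 1"
    using km by (auto simp: c)
  define N where "N = Beta (real a) (real b)"
  have N: "0 < N"
    using ab by (simp add: N_def Beta_def)
  define w where "w t = t ^ (a - 1) * (1 - t) ^ (b - 1)" for t :: real
  define g where "g t = \<beta> * t + (1 - \<beta>) * c" for t
  have w_nonneg: "0 \<le> w t" if "t \<in> {0..1}" for t
    using that by (simp add: w_def)
  have g01: "g t \<in> {0..1}" if "t \<in> {0..1}" for t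
    unfolding g_def using convexD[of "{0..1}" t c \<beta> "1 - \<beta>"] that c01 \<beta> by auto
  have w_int: "(w has_integral N) {0..1}"
    unfolding w_def N_def using ab by (rule has_integral_Beta_nat)
  have w_var: "((\<lambda>t. w t * (t - c)\<^sup>2) has_integral
      N * (c * (1 - c) / ((real m)\<^sup>2 + 1))) {0..1}"
    unfolding w_def N_def using has_integral_Beta_variance[OF ab c_ab] by (simp add: sum_ab)
  have "continuous_on {0..1} (\<lambda>t. f (g t))"
    by (intro continuous_on_compose2[OF f]) (auto simp: g_def intro!: continuous_intros g01[unfolded g_def])
  then have cont: "continuous_on {0..1} (\<lambda>t. w t * f (g t))"
    unfolding w_def by (intro continuous_intros)
  define I where "I = integral {0..1} (\<lambda>t. w t * f (g t))"
  have "((\<lambda>t. w t * f (g t)) has_integral I) {0..1}"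
    unfolding I_def using cont by (intro integrable_integral integrable_continuous_real)
  then have I: "((\<lambda>t. w t * f (g t) - w t * y) has_integral I - N * y) {0..1}"
    by (intro has_integral_diff has_integral_mult_left w_int)
  have U: "((\<lambda>t. w t * (A + B * (2 * (c - x)\<^sup>2)) + 2 * B * (w t * (t - c)\<^sup>2)) has_integral
      N * (A + B * (2 * (c - x)\<^sup>2)) + 2 * B * (N * (c * (1 - c) / ((real m)\<^sup>2 + 1)))) {0..1}"
    by (intro has_integral_add has_integral_mult_left has_integral_mult_right w_int w_var)
  have bound: "norm (w t * f (g t) - w t * y) \<le>
      w t * (A + B * (2 * (c - x)\<^sup>2)) + 2 * B * (w t * (t - c)\<^sup>2)" if t: "t \<in> {0..1}" for t
  proof -
    \<comment> \<open>The deviation splits into fluctuation about the mean and bias of the mean.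
      Since \<open>\<beta> \<le> 1\<close>, the fluctuation is bounded uniformly in
      \<open>\<beta>\<close>.\<close>
    have "(g t - x)\<^sup>2 = (\<beta> * (t - c) + (c - x))\<^sup>2"
      by (simp add: g_def algebra_simps)
    also have "\<dots> \<le> 2 * (\<beta> * (t - c))\<^sup>2 + 2 * (c - x)\<^sup>2"
      using sum_squares_bound[of "\<beta> * (t - c)" "c - x"] by (simp add: power2_sum)
    also have "(\<beta> * (t - c))\<^sup>2 \<le> (t - c)\<^sup>2"
      using \<beta> by (simp add: power_mult_distrib mult_left_le_one_le power_le_one)
    finally have "B * (g t - x)\<^sup>2 \<le> B * (2 * (t - c)\<^sup>2 + 2 * (c - x)\<^sup>2)"
      using B by (intro mult_left_mono) auto
    then have "\<bar>f (g t) - y\<bar> \<le> A + B * (2 * (t - c)\<^sup>2 + 2 * (c - x)\<^sup>2)"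
      using le[OF g01[OF t]] by linarith
    then have "w t * \<bar>f (g t) - y\<bar> \<le> w t * (A + B * (2 * (t - c)\<^sup>2 + 2 * (c - x)\<^sup>2))"
      using w_nonneg[OF t] by (intro mult_left_mono)
    moreover have "norm (w t * f (g t) - w t * y) = w t * \<bar>f (g t) - y\<bar>"
      using w_nonneg[OF t] by (simp add: abs_mult flip: right_diff_distrib)
    ultimately show ?thesis
      by (simp add: algebra_simps)
  qed
  have "norm (integral {0..1} (\<lambda>t. w t * f (g t) - w t * y)) \<le>
      integral {0..1} (\<lambda>t. w t * (A + B * (2 * (c - x)\<^sup>2)) + 2 * B * (w t * (t - c)\<^sup>2))"
    using I U bound by (intro integral_norm_bound_integral) auto
  then have "\<bar>I - N * y\<bar> \<le>
      N * (A + B * (2 * (c * (1 - c) / ((real m)\<^sup>2 + 1)) + 2 * (c - x)\<^sup>2))"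
    using I U by (simp add: integral_unique algebra_simps)
  moreover have "beta_functional \<beta> m k f = I / N"
    using False by (simp add: beta_functional_def I_def N_def w_def g_def a_def b_def c)
  moreover have "\<bar>I / N - y\<bar> = \<bar>I - N * y\<bar> / N"
    using N by (simp add: field_simps abs_div_pos[symmetric])
  ultimately have "\<bar>beta_functional \<beta> m k f - y\<bar> \<le>
      A + B * (2 * (c * (1 - c) / ((real m)\<^sup>2 + 1)) + 2 * (c - x)\<^sup>2)"
    using N by (simp add: pos_divide_le_eq mult.commute)
  also have "\<dots> \<le> A + B * (2 * (c * (1 - c) / (real m)\<^sup>2) + 2 * (c - x)\<^sup>2)"
    using B c01 km
    by (intro add_mono mult_left_mono divide_left_mono mult_nonneg_nonneg mult_pos_pos)
      (auto simp: add_pos_pos)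
  finally show ?thesis .
qed

section \<open>Binomial moments and the second moment at the nodes\<close>

text \<open>Writing \<open>k * (n - k) = (n - 1) * k - k * (k - 1)\<close> reduces the sum to the
  first two factorial moments.\<close>

lemma sum_bern_mult:
  "(\<Sum>k\<le>n. bern n k x * (real k * (real n - real k))) = real n * (real n - 1) * (x * (1 - x))"
proof -
  have "(\<Sum>k\<le>n. bern n k x * (real k * (real n - real k))) =
      (real n - 1) * (\<Sum>k\<le>n. real k * Bernstein n k x)
      - (\<Sum>k\<le>n. real k * (real k - 1) * Bernstein n k x)"
    unfolding bern_eq_Bernstein sum_distrib_left sum_subtractf[symmetric]
    by (intro sum.cong) (auto simp: algebra_simps)
  also have "\<dots> = real n * (real n - 1) * (x * (1 - x))"
    by (simp only: sum_k_Bernstein sum_kk_Bernstein) (simp add: algebra_simps power2_eq_square)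
  finally show ?thesis .
qed

lemma sum_bern_variance:
  assumes "0 < n"
  shows "(\<Sum>k\<le>n. bern n k x * (real k / real n - x)\<^sup>2) = x * (1 - x) / real n"
proof -
  have "(\<Sum>k\<le>n. bern n k x * (real k / real n - x)\<^sup>2) =
      ((\<Sum>k\<le>n. real k * (real k - 1) * Bernstein n k x)
        + (1 - 2 * real n * x) * (\<Sum>k\<le>n. real k * Bernstein n k x)
        + (real n * x)\<^sup>2 * (\<Sum>k\<le>n. Bernstein n k x)) / (real n)\<^sup>2"
    unfolding bern_eq_Bernstein sum_distrib_left sum.distrib[symmetric] sum_divide_distrib
    using assms by (intro sum.cong) (auto simp: field_simps power2_eq_square)
  also have "\<dots> = x * (1 - x) / real n"
    unfolding sum_k_Bernstein sum_kk_Bernstein sum_Bernstein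
    using assms by (simp add: field_simps power2_eq_square)
  finally show ?thesis .
qed

text \<open>The mean of the functional with index \<open>k\<close>, whose degree is
  \<open>n - 1\<close>. At \<open>k = n\<close> the operator evaluates at 1, whereas the quotient
  would exceed 1.\<close>

definition node :: "nat \<Rightarrow> nat \<Rightarrow> real" where
  "node n k = (if k = n then 1 else real k / real (n - 1))"

text \<open>Both the variance term and the shift from \<open>k / n\<close> to the node are dominated
  by multiples of \<open>k * (n - k)\<close>. This vanishes at \<open>k = 0\<close> and
  \<open>k = n\<close>, and so its binomial mean retains the factor \<open>x * (1 - x)\<close>,
  which a bound uniform in \<open>k\<close> would lose.\<close>

lemma sum_bern_node:
  assumes n: "2 \<le> n" and x: "x \<in> {0..1}"
  shows "(\<Sum>k\<le>n. bern n k x *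
      (2 * (node n k * (1 - node n k) / (real (n - 1))\<^sup>2) + 2 * (node n k - x)\<^sup>2))
    \<le> 20 * (x * (1 - x) / real n)"
proof -
  define m where "m = real (n - 1)"
  define N where "N = real n"
  have m: "1 \<le> m" "m = N - 1" "N \<le> 2 * m" "0 < N"
    using n by (auto simp: m_def N_def of_nat_diff)
  define X where "X = x * (1 - x)"
  have X: "0 \<le> X"
    using x by (simp add: X_def)
  have bound: "2 * (node n k * (1 - node n k) / m\<^sup>2) + 2 * (node n k - x)\<^sup>2 \<le>
      (2 / m ^ 4 + 4 / (m\<^sup>2 * N)) * (real k * (N - real k)) + 4 * (real k / N - x)\<^sup>2"
    if k: "k \<le> n" for k
  proof -
    let ?c = "node n k" and ?K = "real k * (N - real k)"
    have *: "?c * (1 - ?c) \<le> ?K / m\<^sup>2 \<and> (?c - real k / N)\<^sup>2 \<le> ?K / (m\<^sup>2 * N)"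
    proof (cases "k = n")
      case True
      then show ?thesis
        using m by (simp add: node_def N_def)
    next
      case False
      then have c: "?c = real k / m" and k1: "real k + 1 \<le> N"
        using k by (auto simp: node_def m_def N_def)
      have "?c * (1 - ?c) = real k * (m - real k) / m\<^sup>2"
        using m(1) by (simp add: c field_simps power2_eq_square)
      also have "\<dots> \<le> ?K / m\<^sup>2"
        using m by (intro divide_right_mono mult_left_mono) auto
      finally have 1: "?c * (1 - ?c) \<le> ?K / m\<^sup>2" .
      have "?c - real k / N = real k / (m * N)"
        using m(1,4) unfolding c by (simp add: field_simps) (simp add: m(2) algebra_simps)
      then have "(?c - real k / N)\<^sup>2 = (real k * real k / N) / (m\<^sup>2 * N)"
        by (simp add: power2_eq_square)
      also have "\<dots> \<le> ?K / (m\<^sup>2 * N)"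
      proof (intro divide_right_mono)
        \<comment> \<open>For \<open>k < n\<close> one has \<open>k / n \<le> 1 \<le> n - k\<close>,
          which turns the square of \<open>k\<close> into \<open>k * (n - k)\<close>.\<close>
        have "real k / N \<le> 1"
          using k1 m(4) by simp
        then have "real k / N \<le> N - real k"
          using k1 by linarith
        then have "real k * (real k / N) \<le> real k * (N - real k)"
          by (intro mult_left_mono) auto
        then show "real k * real k / N \<le> ?K"
          by simp
      qed (use m in auto)
      finally show ?thesis
        using 1 by simp
    qed
    have "(?c - x)\<^sup>2 = ((?c - real k / N) + (real k / N - x))\<^sup>2"
      by simp
    also have "\<dots> \<le> 2 * (?c - real k / N)\<^sup>2 + 2 * (real k / N - x)\<^sup>2"
      using sum_squares_bound[of "?c - real k / N" "real k / N - x"] unfolding power2_sum by linarith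
    finally have "(?c - x)\<^sup>2 \<le> 2 * (?K / (m\<^sup>2 * N)) + 2 * (real k / N - x)\<^sup>2"
      using * by linarith
    moreover have "?c * (1 - ?c) / m\<^sup>2 \<le> ?K / m\<^sup>2 / m\<^sup>2"
      using * m by (intro divide_right_mono) auto
    moreover have "?K / m\<^sup>2 / m\<^sup>2 = ?K / m ^ 4"
      by (simp add: power_add[symmetric])
    moreover have "(2 / m ^ 4 + 4 / (m\<^sup>2 * N)) * ?K = 2 * (?K / m ^ 4) + 4 * (?K / (m\<^sup>2 * N))"
      by (simp add: distrib_right)
    ultimately show ?thesis
      by linarith
  qed
  have "(\<Sum>k\<le>n. bern n k x * (2 * (node n k * (1 - node n k) / m\<^sup>2) + 2 * (node n k - x)\<^sup>2))
      \<le> (\<Sum>k\<le>n. bern n k x * ((2 / m ^ 4 + 4 / (m\<^sup>2 * N)) * (real k * (N - real k))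
          + 4 * (real k / N - x)\<^sup>2))"
    using bound x by (intro sum_mono mult_left_mono) (auto simp: bern_nonneg)
  also have "\<dots> = (2 / m ^ 4 + 4 / (m\<^sup>2 * N)) * (\<Sum>k\<le>n. bern n k x * (real k * (N - real k)))
      + 4 * (\<Sum>k\<le>n. bern n k x * (real k / N - x)\<^sup>2)"
    by (simp only: sum_distrib_left sum.distrib[symmetric] distrib_left mult.left_commute)
  also have "\<dots> = (2 / m ^ 4 + 4 / (m\<^sup>2 * N)) * (N * m * X) + 4 * (X / N)"
    using n by (simp add: sum_bern_mult sum_bern_variance N_def X_def m_def of_nat_diff)
  also have "\<dots> = (2 * ((N / m)\<^sup>2 / m) + 4 * (N / m) + 4) * (X / N)"
    using m(1,4) by (simp add: field_simps power2_eq_square eval_nat_numeral)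
  \<comment> \<open>From \<open>N / m \<le> 2\<close> and \<open>m \<ge> 1\<close>; the total is
    \<open>8 + 8 + 4 = 20\<close>.\<close>
  also have "\<dots> \<le> (2 * (2\<^sup>2 / 1) + 4 * 2 + 4) * (X / N)"
    using m X
    by (intro mult_right_mono add_mono mult_left_mono frac_le power_mono) (auto simp: field_simps)
  finally show ?thesis
    by (simp add: m_def N_def X_def)
qed

section \<open>The operator: endpoint values and the error under a quadratic majorant\<close>

lemma L_op_eq_sum:
  assumes "2 \<le> n"
  shows "L_op \<alpha> \<beta> n f x = (\<Sum>k\<le>n. bezier_Q \<alpha> n k x *
    (if k = 0 then f 0 else if k = n then f 1 else beta_functional \<beta> (n - 1) k f))"
    (is "_ = sum ?g _")
proof -
  have "{..n} = insert 0 (insert n {1..n - 1})"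
    using assms by auto
  then have "sum ?g {..n} = ?g 0 + (?g n + sum ?g {1..n - 1})"
    using assms by (simp add: sum.insert)
  also have "sum ?g {1..n - 1} = (\<Sum>k=1..n - 1. bezier_Q \<alpha> n k x * beta_functional \<beta> (n - 1) k f)"
    using assms by (intro sum.cong) auto
  finally show ?thesis
    using assms by (simp add: L_op_def algebra_simps)
qed

text \<open>All weights but the first are squeezed between 0 and
  \<open>\<alpha> * bern n k 0 = 0\<close>, and the weights sum to 1. Exact interpolation matters
  because for \<open>lam < 1\<close> the modulus in the theorem has argument 0 at an
  endpoint.\<close>

lemma L_op_0:
  assumes "2 \<le> n" "\<alpha> \<ge> 1"
  shows "L_op \<alpha> \<beta> n f 0 = f 0"
proof -
  have Q: "bezier_Q \<alpha> n k 0 = 0" if "k \<in> {..n} - {0}" for k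
    using that assms bezier_Q_nonneg[of 0 k n \<alpha>] bezier_Q_le_bern[of 0 k n \<alpha>]
    by (simp add: bern_def zero_power)
  have "(\<Sum>k\<le>n. bezier_Q \<alpha> n k 0) = bezier_Q \<alpha> n 0 0"
    using Q by (subst sum.remove[of _ 0]) auto
  then have "bezier_Q \<alpha> n 0 0 = 1"
    using assms by (simp add: sum_bezier_Q)
  then show ?thesis
    unfolding L_op_eq_sum[OF assms(1)] using Q by (subst sum.remove[of _ 0]) auto
qed

lemma L_op_1:
  assumes "2 \<le> n" "\<alpha> \<ge> 1"
  shows "L_op \<alpha> \<beta> n f 1 = f 1"
proof -
  have Q: "bezier_Q \<alpha> n k 1 = 0" if "k \<in> {..n} - {n}" for k
    using that assms bezier_Q_nonneg[of 1 k n \<alpha>] bezier_Q_le_bern[of 1 k n \<alpha>]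
    by (simp add: bern_def zero_power)
  have "(\<Sum>k\<le>n. bezier_Q \<alpha> n k 1) = bezier_Q \<alpha> n n 1"
    using Q by (subst sum.remove[of _ n]) auto
  then have "bezier_Q \<alpha> n n 1 = 1"
    using assms by (simp add: sum_bezier_Q)
  then show ?thesis
    unfolding L_op_eq_sum[OF assms(1)] using Q assms by (subst sum.remove[of _ n]) auto
qed

text \<open>As the weights sum to 1, the error is a weighted mean of the deviations of the
  functionals from \<open>f x\<close>. Comparing the nonnegative weights with
  \<open>\<alpha> * bern n k x\<close> then leaves the moment sum over the nodes.\<close>

lemma L_op_diff_le:
  assumes f: "continuous_on {0..1} f" and n: "2 \<le> n" and \<alpha>: "\<alpha> \<ge> 1" and \<beta>: "0 \<le> \<beta>" "\<beta> \<le> 1"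
    and x: "x \<in> {0..1}" and A: "0 \<le> A" and B: "0 \<le> B"
    and le: "\<And>t. t \<in> {0..1} \<Longrightarrow> \<bar>f t - f x\<bar> \<le> A + B * (t - x)\<^sup>2"
  shows "\<bar>L_op \<alpha> \<beta> n f x - f x\<bar> \<le> \<alpha> * (A + B * (20 * (x * (1 - x) / real n)))"
proof -
  define F where
    "F k = (if k = 0 then f 0 else if k = n then f 1 else beta_functional \<beta> (n - 1) k f)" for k
  define v where "v k = 2 * (node n k * (1 - node n k) / (real (n - 1))\<^sup>2) + 2 * (node n k - x)\<^sup>2" for k
  have v: "\<bar>F k - f x\<bar> \<le> A + B * v k" if k: "k \<le> n" for k
  proof -
    consider "k = 0" | "k = n" | "1 \<le> k" "k \<le> n - 1" "k \<noteq> n"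
      using k by linarith
    then show ?thesis
    proof cases
      case 1
      have "B * (0 - x)\<^sup>2 \<le> B * (2 * (0 - x)\<^sup>2)"
        using B by (intro mult_left_mono) auto
      then show ?thesis
        using 1 n le[of 0] by (simp add: F_def v_def node_def)
    next
      case 2
      have "B * (1 - x)\<^sup>2 \<le> B * (2 * (1 - x)\<^sup>2)"
        using B by (intro mult_left_mono) auto
      then show ?thesis
        using 2 n le[of 1] by (simp add: F_def v_def node_def)
    next
      \<comment> \<open>The index \<open>k = n - 1\<close> is included: there the functional is
        evaluation at 1 and the node is 1.\<close>
      case 3
      then show ?thesis
        using beta_functional_diff_le[OF f 3(1,2) \<beta> B le, of "node n k"]
        by (simp add: F_def v_def node_def)
    qed
  qed
  have "L_op \<alpha> \<beta> n f x - f x = (\<Sum>k\<le>n. bezier_Q \<alpha> n k x * (F k - f x))"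
    unfolding L_op_eq_sum[OF n] F_def[symmetric]
    by (simp add: right_diff_distrib sum_subtractf sum_bezier_Q[OF \<alpha>] flip: sum_distrib_right)
  then have "\<bar>L_op \<alpha> \<beta> n f x - f x\<bar> \<le> (\<Sum>k\<le>n. \<bar>bezier_Q \<alpha> n k x * (F k - f x)\<bar>)"
    by (simp add: sum_abs)
  also have "\<dots> \<le> (\<Sum>k\<le>n. \<alpha> * bern n k x * (A + B * v k))"
    unfolding abs_mult using v x \<alpha>
    by (intro sum_mono mult_mono) (auto simp: bezier_Q_nonneg bezier_Q_le_bern bern_nonneg)
  also have "\<dots> = \<alpha> * (A * (\<Sum>k\<le>n. bern n k x) + B * (\<Sum>k\<le>n. bern n k x * v k))"
    unfolding sum_distrib_left sum.distrib[symmetric]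
    by (intro sum.cong) (auto simp: algebra_simps)
  also have "\<dots> \<le> \<alpha> * (A * 1 + B * (20 * (x * (1 - x) / real n)))"
    using sum_bern_node[OF n x] \<alpha> A B
    by (intro mult_left_mono add_mono) (auto simp: sum_bern v_def)
  finally show ?thesis
    by simp
qed

section \<open>Choice of the step size and the final constant\<close>

theorem theorem2:
  fixes f :: "real \<Rightarrow> real" and \<alpha> \<beta> lam :: real
  assumes "continuous_on {0..1} f"
    and "\<alpha> \<ge> 1"
    and "0 \<le> \<beta>" and "\<beta> \<le> 1"
    and "0 \<le> lam" and "lam \<le> 1"
  shows "\<exists>M>0. \<forall>n\<ge>2. \<forall>x\<in>{0..1}.
    \<bar>L_op \<alpha> \<beta> n f x - f x\<bar> \<le> M * DT_modulus lam f (phi_pow (1 - lam) x / sqrt (real n))"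
\<comment> \<open>The constant is \<open>\<alpha> * (4 + 2 * 20)\<close>: 4 and 2 come from the
  quadratic majorant below, 20 from the moment sum.\<close>
proof (intro exI[of _ "44 * \<alpha>"] conjI allI impI ballI)
  fix n :: nat and x :: real
  assume n: "2 \<le> n" and x: "x \<in> {0..1}"
  define h where "h = phi_pow (1 - lam) x / sqrt (real n)"
  define W where "W = DT_modulus lam f h"
  have h: "0 \<le> h"
    by (simp add: h_def phi_pow_nonneg)
  have W: "0 \<le> W"
    unfolding W_def using assms(1) h by (rule DT_modulus_nonneg)
  have "\<bar>L_op \<alpha> \<beta> n f x - f x\<bar> \<le> 44 * \<alpha> * W"
  proof (cases "x = 0 \<or> x = 1")
    case True
    then show ?thesis
      using W assms n by (auto simp: L_op_0 L_op_1)
  next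
    case False
    then have x': "0 < x" "x < 1"
      using x by auto
    \<comment> \<open>The complementary powers multiply to \<open>phi x\<close>, so
      \<open>e\<^sup>2\<close> equals \<open>x * (1 - x) / n\<close> and cancels the second moment
      exactly, independently of \<open>lam\<close>.\<close>
    define e where "e = h * phi_pow lam x"
    have "phi_pow (1 - lam) x * phi_pow lam x = sqrt (x * (1 - x))"
      using x' by (simp add: phi_pow_eq_powr powr_half_sqrt flip: powr_add add_divide_distrib)
    then have "e = sqrt (x * (1 - x) / real n)"
      by (simp add: e_def h_def real_sqrt_divide)
    then have e2: "e\<^sup>2 = x * (1 - x) / real n"
      using x by simp
    have h_pos: "0 < h"
      using x' n by (simp add: h_def phi_pow_pos)
    have "0 < e"
      using h_pos x' by (simp add: e_def phi_pow_pos)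
    have "\<bar>f t - f x\<bar> \<le> 4 * W + 2 * W / e\<^sup>2 * (t - x)\<^sup>2" if "t \<in> {0..1}" for t
    proof -
      let ?u = "\<bar>t - x\<bar> / e"
      have "\<bar>f t - f x\<bar> \<le> (2 + 4 * \<bar>t - x\<bar> / e) * W"
        unfolding W_def e_def using that
        by (intro diff_le_chain_DT_modulus assms h_pos x') auto
      \<comment> \<open>From \<open>2 * u \<le> u\<^sup>2 + 1\<close>: the linear growth in the
        distance becomes quadratic, as the second-moment estimate requires.\<close>
      also have "2 + 4 * \<bar>t - x\<bar> / e \<le> 4 + 2 * ?u\<^sup>2"
        using sum_squares_bound[of ?u 1] by simp
      finally show ?thesis
        using W by (simp add: mult_right_mono power_divide algebra_simps)
    qed
    then have "\<bar>L_op \<alpha> \<beta> n f x - f x\<bar> \<le> \<alpha> * (4 * W + 2 * W / e\<^sup>2 * (20 * (x * (1 - x) / real n)))"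
      using W by (intro L_op_diff_le assms n x) auto
    also have "\<dots> = 44 * \<alpha> * W"
      unfolding e2[symmetric] using \<open>0 < e\<close> by simp
    finally show ?thesis .
  qed
  then show "\<bar>L_op \<alpha> \<beta> n f x - f x\<bar> \<le>
      44 * \<alpha> * DT_modulus lam f (phi_pow (1 - lam) x / sqrt (real n))"
    by (simp add: W_def h_def)
qed (use assms in auto)

end
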